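(* Let $G$ be a finite simple undirected connected graph with vertex set $V$, $|V|=n$, edge set $E$, $|E|=m\ge 1$, vertex degrees $d_i$ ($i\in V$) and radius $r$. Put $$\nu=\frac{n\sum_{i\in V}d_i^2}{4m^2},\qquad H(G)=\sum_{ij\in E}\frac{2}{d_i+d_j}.$$ Then $$H(G)\ge\frac{n}{2\nu}\ge\frac{m}{n-r}.$$
   Context: The quantity $\nu$ is a measure of irregularity of $G$, defined for graphs with at least one edge. $H(G)$ is the Harmonic index of $G$; the sum runs over each (unordered) edge once. The eccentricity $ecc(v)$ of a vertex $v$ in a connected graph $G$ is the maximum distance between $v$ and any other vertex of $G$; the radius $r$ is the minimum eccentricity over all vertices of $G$. *)

theory Defs
  imports Complex_Main "Graph_Theory.Graph_Theory"
begin

text \<open>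
  A finite simple undirected graph is a \<open>graph\<close> in the sense of \<open>Graph_Theory\<close>: a finite,
  loop-free, symmetric digraph without parallel arcs. An undirected edge \<open>{u, v}\<close> is
  there a pair of opposite arcs, and \<open>edges\<close> identifies the two. The out-degree of a vertex
  is its number of neighbours, hence its degree in the undirected graph.
\<close>

definition edges :: "('a, 'b) pre_digraph \<Rightarrow> 'a set set" where
  "edges G = (\<lambda>a. {tail G a, head G a}) ` arcs G"

abbreviation degree :: "('a, 'b) pre_digraph \<Rightarrow> 'a \<Rightarrow> nat" where
  "degree G v \<equiv> out_degree G v"

definition irregularity :: "('a, 'b) pre_digraph \<Rightarrow> real" where
  "irregularity G =
     real (card (verts G)) * (\<Sum>v\<in>verts G. (real (degree G v))\<^sup>2)
       / (4 * (real (card (edges G)))\<^sup>2)"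

text \<open>
  Since there are no loops, every edge \<open>e = {i, j}\<close> has two distinct elements, so the inner
  sum below is \<open>d\<^sub>i + d\<^sub>j\<close>.
\<close>

definition harmonic_index :: "('a, 'b) pre_digraph \<Rightarrow> real" where
  "harmonic_index G = (\<Sum>e\<in>edges G. 2 / (\<Sum>v\<in>e. real (degree G v)))"

text \<open>
  The distance is meaningful only if \<open>v\<close> is reachable from \<open>u\<close>, and the eccentricity only if
  \<open>G\<close> is connected and has at least two vertices; otherwise the \<open>LEAST\<close> or the \<open>Max\<close> is
  unspecified.
\<close>

definition distance :: "('a, 'b) pre_digraph \<Rightarrow> 'a \<Rightarrow> 'a \<Rightarrow> nat" where
  "distance G u v = (LEAST k. \<exists>p. pre_digraph.awalk G u p v \<and> length p = k)"

definition eccentricity :: "('a, 'b) pre_digraph \<Rightarrow> 'a \<Rightarrow> nat" where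
  "eccentricity G v = Max (distance G v ` (verts G - {v}))"

definition radius :: "('a, 'b) pre_digraph \<Rightarrow> nat" where
  "radius G = Min (eccentricity G ` verts G)"

end

theory Submission
  imports Defs
begin

text \<open>
  Double counting of incidences gives \<open>\<Sum>\<^sub>i d\<^sub>i = 2m\<close> and
  \<open>\<Sum>\<^bsub>ij\<in>E\<^esub> (d\<^sub>i + d\<^sub>j) = \<Sum>\<^sub>i d\<^sub>i\<^sup>2\<close>. The first inequality is the
  inequality between the harmonic and the arithmetic mean of the edge weights \<open>d\<^sub>i + d\<^sub>j\<close>.
  For the second one, a vertex \<open>v\<close> of eccentricity \<open>e\<close> has non-neighbours at each of the
  \<open>e\<close> distances \<open>0, 2, 3, \<dots>, e\<close>, so \<open>d\<^sub>v \<le> n - e \<le> n - r\<close>; hence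
  \<open>\<Sum>\<^sub>i d\<^sub>i\<^sup>2 \<le> (n - r) \<Sum>\<^sub>i d\<^sub>i = 2m(n - r)\<close>.
\<close>

lemma card_squared_over_sum_le_sum_inverse:
  fixes f :: "'a \<Rightarrow> real"
  assumes pos: "\<And>x. x \<in> A \<Longrightarrow> f x > 0"
  shows "(real (card A))\<^sup>2 / (\<Sum>x\<in>A. f x) \<le> (\<Sum>x\<in>A. 1 / f x)"
\<comment> \<open>If \<open>A\<close> is empty or infinite, \<open>card A\<close> and both sums are
  0, so both sides are 0.\<close>
proof (cases "finite A \<and> A \<noteq> {}")
  case True
  define S where "S = (\<Sum>x\<in>A. f x)"
  define c where "c = S / card A"
  have S: "S > 0"
    unfolding S_def using True pos by (intro sum_pos) auto
  have k: "real (card A) > 0"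
    using True by (simp add: card_gt_0_iff)
  have c: "c > 0"
    using S k by (simp add: c_def)
  \<comment> \<open>\<open>t \<mapsto> 1 / t\<close> lies above its tangent at the mean \<open>c\<close>\<close>
  have tangent: "2 / c - f x / c\<^sup>2 \<le> 1 / f x" if "x \<in> A" for x
  proof -
    have "1 / f x - (2 / c - f x / c\<^sup>2) = (c - f x)\<^sup>2 / (f x * c\<^sup>2)"
      using c pos[OF that] by (simp add: field_simps power2_eq_square)
    also have "\<dots> \<ge> 0"
      using pos[OF that] by simp
    finally show ?thesis by simp
  qed
  \<comment> \<open>As \<open>c\<close> is the mean of \<open>f\<close>, the tangent values at
    \<open>c\<close> add up to exactly the left-hand side.\<close>
  have "(real (card A))\<^sup>2 / S = card A * (2 / c) - S / c\<^sup>2"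
    using S k by (simp add: c_def field_simps power2_eq_square)
  also have "\<dots> = (\<Sum>x\<in>A. 2 / c - f x / c\<^sup>2)"
    by (simp add: S_def sum_subtractf sum_divide_distrib)
  also have "\<dots> \<le> (\<Sum>x\<in>A. 1 / f x)"
    by (intro sum_mono tangent)
  finally show ?thesis
    by (simp add: S_def)
qed auto

context graph
begin

lemma finite_edges: "finite (edges G)"
  by (simp add: edges_def)

lemma edge_subset_verts: "e \<in> edges G \<Longrightarrow> e \<subseteq> verts G"
  by (auto simp: edges_def)

lemma reverse_arc:
  assumes "a \<in> arcs G"
  obtains b where "b \<in> arcs G" "tail G b = head G a" "head G b = tail G a"
  using sym_arcs assms unfolding symmetric_conv by metis

text \<open>Sending an arc out of \<open>v\<close> to its pair of ends is injective, as there are no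
  parallel arcs. It reaches every edge at \<open>v\<close>: if \<open>v\<close> is the head of the
  chosen arc, the reverse arc leaves \<open>v\<close>.\<close>

lemma degree_eq_card_incident_edges: "degree G v = card {e \<in> edges G. v \<in> e}"
proof -
  have "bij_betw (\<lambda>a. {tail G a, head G a}) (out_arcs G v) {e \<in> edges G. v \<in> e}"
  proof (intro bij_betw_imageI)
    show "inj_on (\<lambda>a. {tail G a, head G a}) (out_arcs G v)"
      by (intro inj_onI no_multi_arcs) (auto simp: arc_to_ends_def doubleton_eq_iff)
    show "(\<lambda>a. {tail G a, head G a}) ` out_arcs G v = {e \<in> edges G. v \<in> e}"
    proof (intro equalityI subsetI)
      fix e assume "e \<in> {e \<in> edges G. v \<in> e}"
      then obtain a where a: "a \<in> arcs G" "e = {tail G a, head G a}" "v \<in> e"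
        by (auto simp: edges_def)
      obtain b where "b \<in> arcs G" "tail G b = head G a" "head G b = tail G a"
        using reverse_arc[OF a(1)] .
      then show "e \<in> (\<lambda>a. {tail G a, head G a}) ` out_arcs G v"
        using a by (cases "v = tail G a") (auto intro: rev_image_eqI)
    qed (auto simp: edges_def)
  qed
  then show ?thesis
    unfolding out_degree_def by (rule bij_betw_same_card)
qed

text \<open>Swapping the sums counts \<open>f v\<close> once per edge at \<open>v\<close>. Both
  double counts are instances: \<open>f\<close> constantly 1, and \<open>f\<close> the
  degree.\<close>

lemma sum_over_edge_ends:
  fixes f :: "'a \<Rightarrow> real"
  shows "(\<Sum>e\<in>edges G. \<Sum>v\<in>e. f v) = (\<Sum>v\<in>verts G. real (degree G v) * f v)"
proof -
  have "(\<Sum>e\<in>edges G. \<Sum>v\<in>e. f v) = (\<Sum>e\<in>edges G. \<Sum>v | v \<in> verts G \<and> v \<in> e. f v)"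
    using edge_subset_verts by (intro sum.cong arg_cong2[where f = sum]) auto
  also have "\<dots> = (\<Sum>v\<in>verts G. \<Sum>e | e \<in> edges G \<and> v \<in> e. f v)"
    by (intro sum.swap_restrict finite_edges finite_verts)
  finally show ?thesis
    by (simp add: degree_eq_card_incident_edges)
qed

lemma card_edge: "e \<in> edges G \<Longrightarrow> card e = 2"
  using no_loops by (auto simp: edges_def)

lemma sum_degree: "(\<Sum>v\<in>verts G. real (degree G v)) = 2 * real (card (edges G))"
  using sum_over_edge_ends[of "\<lambda>_. 1"] by (simp add: card_edge)

lemma sum_degree_over_edge_ends:
  "(\<Sum>e\<in>edges G. \<Sum>v\<in>e. real (degree G v)) = (\<Sum>v\<in>verts G. (real (degree G v))\<^sup>2)"
  using sum_over_edge_ends[of "\<lambda>v. real (degree G v)"] by (simp add: power2_eq_square)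

lemma degree_pos_if_in_edge:
  assumes "e \<in> edges G" "v \<in> e"
  shows "degree G v > 0"
  using assms finite_edges by (auto simp: degree_eq_card_incident_edges card_gt_0_iff)

lemma sum_degree_edge_pos:
  assumes "e \<in> edges G"
  shows "(\<Sum>v\<in>e. real (degree G v)) > 0"
  using assms degree_pos_if_in_edge[OF assms] card_edge[OF assms]
  by (intro sum_pos) (auto intro: card_ge_0_finite)

text \<open>The first inequality of the theorem, with \<open>irregularity G\<close> unfolded and
  \<open>n\<close> cancelled.\<close>

lemma harmonic_index_ge:
  "harmonic_index G \<ge> 2 * (real (card (edges G)))\<^sup>2 / (\<Sum>v\<in>verts G. (real (degree G v))\<^sup>2)"
proof -
  have "(real (card (edges G)))\<^sup>2 / (\<Sum>v\<in>verts G. (real (degree G v))\<^sup>2)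
      \<le> (\<Sum>e\<in>edges G. 1 / (\<Sum>v\<in>e. real (degree G v)))"
    unfolding sum_degree_over_edge_ends[symmetric]
    by (intro card_squared_over_sum_le_sum_inverse sum_degree_edge_pos)
  moreover have "harmonic_index G = 2 * (\<Sum>e\<in>edges G. 1 / (\<Sum>v\<in>e. real (degree G v)))"
    by (simp add: harmonic_index_def sum_distrib_left)
  ultimately show ?thesis by simp
qed

lemma distance_le: "awalk u p v \<Longrightarrow> distance G u v \<le> length p"
  unfolding distance_def by (rule Least_le) blast

lemma shortest_awalk:
  assumes "u \<rightarrow>\<^sup>* v"
  obtains p where "awalk u p v" "length p = distance G u v"
proof -
  obtain q where "awalk u q v"
    using assms by (auto simp: reachable_awalk)
  then have "\<exists>p. awalk u p v \<and> length p = length q"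
    by blast
  then have "\<exists>p. awalk u p v \<and> length p = distance G u v"
    unfolding distance_def by (rule LeastI)
  then show ?thesis using that by blast
qed

lemma distance_neighbour:
  assumes "a \<in> arcs G"
  shows "distance G (tail G a) (head G a) = 1"
proof -
  let ?u = "tail G a" and ?v = "head G a"
  have walk: "awalk ?u [a] ?v"
    using assms by (rule arc_implies_awalk)
  then obtain p where p: "awalk ?u p ?v" "length p = distance G ?u ?v"
    using shortest_awalk reachable_awalk by metis
  have "p \<noteq> []"
    using p(1) no_loops[OF assms] by (auto simp: awalk_Nil_iff)
  then have "length p > 0" by simp
  then show ?thesis
    using p(2) distance_le[OF walk] by simp
qed

text \<open>Cut a shortest walk from \<open>v\<close> to \<open>u\<close> after \<open>k\<close>
  arcs: a shorter way to the cut point, followed by the rest of the walk, would beat the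
  distance.\<close>

lemma distance_intermediate:
  assumes "v \<rightarrow>\<^sup>* u" "k \<le> distance G v u"
  obtains w where "w \<in> verts G" "distance G v w = k"
proof -
  obtain p where p: "awalk v p u" "length p = distance G v u"
    using shortest_awalk[OF assms(1)] .
  define w where "w = awlast v (take k p)"
  have "awalk v (take k p @ drop k p) u"
    using p(1) by simp
  then have walks: "awalk v (take k p) w" "awalk w (drop k p) u"
    unfolding awalk_append_iff w_def by auto
  have "v \<rightarrow>\<^sup>* w"
    using walks(1) by (rule reachable_awalkI)
  then obtain q where q: "awalk v q w" "length q = distance G v w"
    by (rule shortest_awalk)
  have "distance G v u \<le> length (q @ drop k p)"
    using q(1) walks(2) by (intro distance_le awalk_appendI)
  then have "k \<le> distance G v w"
    using p q assms(2) by simp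
  moreover have "distance G v w \<le> k"
    using distance_le[OF walks(1)] by simp
  ultimately show ?thesis
    using that walks(1) by (auto dest: awalk_last_in_verts)
qed

lemma degree_plus_distance_le:
  assumes "v \<rightarrow>\<^sup>* u" "u \<noteq> v"
  shows "degree G v + distance G v u \<le> card (verts G)"
proof -
  define N where "N = head G ` out_arcs G v"
  have N: "N \<subseteq> verts G"
    by (auto simp: N_def)
  have "inj_on (head G) (out_arcs G v)"
    by (intro inj_onI no_multi_arcs) (auto simp: arc_to_ends_def)
  then have card_N: "card N = degree G v"
    by (simp add: N_def out_degree_def card_image)
  \<comment> \<open>A nonzero distance puts 1 into \<open>{0..distance G v u}\<close>, so removing
    it leaves as many elements as the distance.\<close>
  have "distance G v u \<noteq> 0"
    using assms shortest_awalk[OF assms(1)] by (metis awalk_empty_ends length_0_conv)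
  then have "distance G v u = card ({0..distance G v u} - {1})"
    by (simp add: card_Diff_singleton)
  also have "\<dots> \<le> card (distance G v ` (verts G - N))"
  proof (rule card_mono)
    show "{0..distance G v u} - {1} \<subseteq> distance G v ` (verts G - N)"
    proof
      fix k assume k: "k \<in> {0..distance G v u} - {1}"
      then obtain w where w: "w \<in> verts G" "distance G v w = k"
        using distance_intermediate[OF assms(1)] by auto
      moreover have "w \<notin> N"
        using k w distance_neighbour by (auto simp: N_def)
      ultimately show "k \<in> distance G v ` (verts G - N)"
        by blast
    qed
  qed simp
  also have "\<dots> \<le> card (verts G - N)"
    by (simp add: card_image_le)
  also have "\<dots> = card (verts G) - degree G v"
    using N card_N by (simp add: card_Diff_subset finite_subset[OF N])
  \<comment> \<open>The bound \<open>card N \<le> card (verts G)\<close> keeps the natural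
    subtraction from truncating.\<close>
  finally show ?thesis
    using card_mono[OF finite_verts N] card_N by linarith
qed

text \<open>A second vertex makes the \<open>Max\<close> in \<open>eccentricity\<close> range over a
  nonempty set, so that some \<open>u\<close> attains it; the previous bound applies to this
  \<open>u\<close>.\<close>

lemma degree_plus_radius_le:
  assumes "Digraph_Component.connected G" "v \<in> verts G" "verts G \<noteq> {v}"
  shows "degree G v + radius G \<le> card (verts G)"
proof -
  have "eccentricity G v \<in> distance G v ` (verts G - {v})"
    unfolding eccentricity_def using assms(2,3) by (intro Max_in) auto
  then obtain u where u: "u \<in> verts G" "u \<noteq> v" "eccentricity G v = distance G v u"
    by auto
  have "v \<rightarrow>\<^sup>* u"
    using symmetric_connected_imp_strongly_connected[OF sym_arcs assms(1)] u(1) assms(2)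
    by auto
  then have "degree G v + eccentricity G v \<le> card (verts G)"
    using degree_plus_distance_le u by simp
  moreover have "radius G \<le> eccentricity G v"
    unfolding radius_def using assms(2) by (intro Min_le) auto
  ultimately show ?thesis by simp
qed

end

theorem theorem6:
  fixes G :: "('a, 'b) pre_digraph"
    and n m r :: nat
    and \<nu> :: real
  assumes "graph G"
    and "Digraph_Component.connected G"
    and "n = card (verts G)"
    and "m = card (edges G)"
    and "m \<ge> 1"
    and "r = radius G"
    and "\<nu> = irregularity G"
  shows "harmonic_index G \<ge> real n / (2 * \<nu>) \<and>
         real n / (2 * \<nu>) \<ge> real m / (real n - real r)"
proof -
  interpret graph G by fact
  define D where "D = (\<Sum>v\<in>verts G. (real (degree G v))\<^sup>2)"
  obtain e where e: "e \<in> edges G"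
    using assms(4,5) by (metis card.empty ex_in_conv not_one_le_zero)
  have two: "verts G \<noteq> {v}" for v
    using edge_subset_verts[OF e] card_edge[OF e] card_mono[of "{v}" e] by auto
  have deg: "real (degree G v) \<le> real n - real r" if "v \<in> verts G" for v
    using degree_plus_radius_le[OF assms(2) that two] assms(3,6) by linarith
  \<comment> \<open>An end of an edge has positive degree, so the degree bound there forces
    \<open>n - r\<close> to be positive.\<close>
  obtain v where v: "v \<in> e"
    using card_edge[OF e] by fastforce
  then have v_pos: "degree G v > 0" and v_vert: "v \<in> verts G"
    using degree_pos_if_in_edge edge_subset_verts e by auto
  have nr: "real n - real r > 0"
    using deg[OF v_vert] v_pos by linarith
  have "n > 0"
    using v_vert assms(3) by (auto simp: card_gt_0_iff)
  have "D > 0"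
    unfolding D_def sum_degree_over_edge_ends[symmetric]
    using e by (intro sum_pos[OF finite_edges _ sum_degree_edge_pos]) auto
  have D_le: "D \<le> (real n - real r) * (2 * real m)"
  proof -
    have "D \<le> (\<Sum>v\<in>verts G. (real n - real r) * real (degree G v))"
      unfolding D_def power2_eq_square using deg by (intro sum_mono mult_right_mono) auto
    also have "\<dots> = (real n - real r) * (2 * real m)"
      unfolding assms(4) sum_degree[symmetric] by (simp add: sum_distrib_left)
    finally show ?thesis .
  qed
  have \<nu>: "real n / (2 * \<nu>) = 2 * (real m)\<^sup>2 / D"
    using \<open>n > 0\<close> \<open>D > 0\<close> assms(5)
    by (simp add: assms(7) irregularity_def D_def[symmetric] assms(3,4)[symmetric] field_simps)
  \<comment> \<open>After clearing the positive denominators this is \<open>D_le\<close> multiplied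
    by \<open>m\<close>.\<close>
  have "real m / (real n - real r) \<le> 2 * (real m)\<^sup>2 / D"
    using D_le nr \<open>D > 0\<close> mult_left_mono[OF D_le, of "real m"]
    by (simp add: field_simps power2_eq_square)
  then show ?thesis
    using harmonic_index_ge unfolding \<nu> D_def assms(4) by blast
qed

end
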